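(* Let $D$ be a holomorphic homogeneous regular domain in $\mathbb{C}^n$. Then the Carathéodory metric on $D$ is complete, i.e. $(D,C_D)$ is a complete metric space.
   Context: $B^n$ is the open unit ball in $\mathbb{C}^n$ and $B^n(0,r)$ is the open ball with center $0$ and radius $r$. For a bounded domain $D\subset\mathbb{C}^n$ and $p\in D$, the squeezing function is $s_D(p)=\sup_f\,\sup\{r : B^n(0,r)\subset f(D)\}$, where the outer supremum is over all (open) injective holomorphic maps $f: D\rightarrow B^n$ with $f(p)=0$. A holomorphic homogeneous regular domain is a bounded domain $D\subset\mathbb{C}^n$ whose squeezing function has a positive lower bound: there is $c>0$ with $s_D(p)\ge c$ for all $p\in D$. $C_D(\cdot,\cdot)$ is the Carathéodory distance on $D$, $C_D(x,y)=\sup\{P_\Delta(f(x),f(y)) : f:D\to\Delta\text{ holomorphic}\}$, where $P_\Delta$ is the Poincaré distance on the unit disc $\Delta$ normalized by $P_\Delta(0,z)=\log\frac{1+|z|}{1-|z|}$. *)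

theory Defs
  imports "HOL-Complex_Analysis.Complex_Analysis"
begin

text \<open>
  Complex \<open>n\<close>-space is \<^typ>\<open>complex ^ 'n\<close> with its Euclidean norm. A function is holomorphic if its
  (Frechet) derivative exists and is complex linear at every point; \<open>has_derivative\<close> itself only
  provides real linearity, and additivity of \<open>f'\<close>. Maps are holomorphic componentwise.
\<close>

definition holomorphic_fun_on :: "(complex ^ 'n \<Rightarrow> complex) \<Rightarrow> (complex ^ 'n) set \<Rightarrow> bool" where
  "holomorphic_fun_on f D \<longleftrightarrow>
     (\<forall>z\<in>D. \<exists>f'. (f has_derivative f') (at z within D) \<and> (\<forall>c v. f' (c *s v) = c * f' v))"

definition holomorphic_map_on :: "(complex ^ 'n \<Rightarrow> complex ^ 'm) \<Rightarrow> (complex ^ 'n) set \<Rightarrow> bool" where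
  "holomorphic_map_on f D \<longleftrightarrow> (\<forall>i. holomorphic_fun_on (\<lambda>z. f z $ i) D)"

definition bounded_domain :: "(complex ^ 'n) set \<Rightarrow> bool" where
  "bounded_domain D \<longleftrightarrow> open D \<and> connected D \<and> D \<noteq> {} \<and> bounded D"

definition squeezing_maps :: "(complex ^ 'n) set \<Rightarrow> complex ^ 'n \<Rightarrow> (complex ^ 'n \<Rightarrow> complex ^ 'n) set" where
  "squeezing_maps D p =
     {f. holomorphic_map_on f D \<and> inj_on f D \<and> open_map (top_of_set D) euclidean f \<and>
         f ` D \<subseteq> ball 0 1 \<and> f p = 0}"

text \<open>
  Both suprema are of nonempty sets bounded by \<open>1\<close> if \<open>D\<close> is a bounded domain and \<open>p \<in> D\<close>: a suitable
  affine map belongs to \<open>squeezing_maps D p\<close>, and \<open>f ` D\<close> is an open subset of the unit ball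
  containing \<open>0\<close>. (Balls of radius \<open>r \<le> 0\<close> are empty and do not affect the supremum.)
\<close>

definition squeezing_function :: "(complex ^ 'n) set \<Rightarrow> complex ^ 'n \<Rightarrow> real" where
  "squeezing_function D p = (SUP f\<in>squeezing_maps D p. Sup {r::real. ball 0 r \<subseteq> f ` D})"

definition holomorphic_homogeneous_regular :: "(complex ^ 'n) set \<Rightarrow> bool" where
  "holomorphic_homogeneous_regular D \<longleftrightarrow>
     bounded_domain D \<and> (\<exists>c>0. \<forall>p\<in>D. c \<le> squeezing_function D p)"

text \<open>
  The Poincare distance of the unit disc: \<open>Moebius_function 0 z\<close> is the disc automorphism
  \<open>w \<mapsto> (w - z) / (1 - cnj z * w)\<close> taking \<open>z\<close> to \<open>0\<close>, which reduces the distance to the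
  case where one point is \<open>0\<close>.
\<close>

definition poincare_dist :: "complex \<Rightarrow> complex \<Rightarrow> real" where
  "poincare_dist z w =
     ln ((1 + norm (Moebius_function 0 z w)) / (1 - norm (Moebius_function 0 z w)))"

lemma poincare_dist_0: "poincare_dist 0 z = ln ((1 + norm z) / (1 - norm z))"
  by (simp add: poincare_dist_def Moebius_function_simple)

text \<open>
  The value \<open>0\<close> off \<open>D\<close> is immaterial, but the locale \<open>Metric_space\<close> demands that a distance be
  nonnegative and symmetric on the whole type. For \<open>x\<close> and \<open>y\<close> in a domain \<open>D\<close> the supremum is finite:
  the Schwarz-Pick lemma bounds it on balls inside \<open>D\<close>, and \<open>x\<close> and \<open>y\<close> are joined by a finite chain
  of such balls.
\<close>

definition caratheodory_dist :: "(complex ^ 'n) set \<Rightarrow> complex ^ 'n \<Rightarrow> complex ^ 'n \<Rightarrow> real" where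
  "caratheodory_dist D x y =
     (if x \<in> D \<and> y \<in> D
      then SUP f\<in>{f. holomorphic_fun_on f D \<and> f ` D \<subseteq> ball 0 1}. poincare_dist (f x) (f y)
      else 0)"

end

theory Submission
  imports Defs
begin

text \<open>
  For a suitable radius, all Caratheodory balls are relatively compact in \<open>D\<close>: a squeezing map \<open>f\<close> at \<open>p\<close>
  takes values in the unit ball, so \<open>C\<^sub>D p z\<close> is at least the Poincare distance of \<open>0\<close> and \<open>|f z|\<close>,
  and hence a small Caratheodory ball about \<open>p\<close> lies in the preimage under \<open>f\<close> of a closed ball contained in
  \<open>f ` D\<close>. The lower bound of the squeezing function makes this radius independent of \<open>p\<close>. So a tail
  of a Cauchy sequence stays in a compact subset of \<open>D\<close>; a Euclidean limit of a subsequence is also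
  a limit for the Caratheodory distance by the Schwarz-Pick lemma.
\<close>

subsection \<open>The Poincare distance\<close>

text \<open>\<open>artanh\<close> carries a factor 1/2, which the normalization of the Poincare
  distance here does not; hence the 2 in all later estimates.\<close>

lemma poincare_dist_artanh: "poincare_dist z w = 2 * artanh (norm (Moebius_function 0 z w))"
  by (simp add: poincare_dist_def artanh_def)

lemma artanh_real_mono:
  fixes x y :: real
  assumes "0 \<le> x" "x \<le> y" "y < 1"
  shows "artanh x \<le> artanh y"
proof -
  have "(1 + x) / (1 - x) \<le> (1 + y) / (1 - y)"
    using assms by (intro frac_le) auto
  moreover have "0 < (1 + x) / (1 - x)"
    using assms by auto
  ultimately show ?thesis
    by (simp add: artanh_def)
qed

lemma artanh_real_strict_mono:
  fixes x y :: real
  assumes "0 \<le> x" "x < y" "y < 1"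
  shows "artanh x < artanh y"
proof -
  have "(1 + x) / (1 - x) < (1 + y) / (1 - y)"
    using assms by (intro frac_less) auto
  moreover have "0 < (1 + x) / (1 - x)"
    using assms by auto
  ultimately show ?thesis
    by (simp add: artanh_def)
qed

text \<open>The addition law turns the bound of \<open>norm_Moebius_function_le\<close> into a sum
  of distances, that is, into the triangle inequality.\<close>

lemma artanh_real_add:
  fixes x y :: real
  assumes "0 \<le> x" "x < 1" "0 \<le> y" "y < 1"
  shows "artanh x + artanh y = artanh ((x + y) / (1 + x * y))"
proof -
  have pos: "0 < 1 + x * y"
    using assms by (simp add: add_pos_nonneg)
  have "1 + (x + y) / (1 + x * y) = (1 + x) * (1 + y) / (1 + x * y)"
    "1 - (x + y) / (1 + x * y) = (1 - x) * (1 - y) / (1 + x * y)"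
    using pos by (simp_all add: field_simps)
  then have "(1 + (x + y) / (1 + x * y)) / (1 - (x + y) / (1 + x * y))
      = ((1 + x) / (1 - x)) * ((1 + y) / (1 - y))"
    using pos assms by simp
  moreover have "ln (((1 + x) / (1 - x)) * ((1 + y) / (1 - y)))
      = ln ((1 + x) / (1 - x)) + ln ((1 + y) / (1 - y))"
    using assms by (intro ln_mult_pos) auto
  ultimately show ?thesis
    by (simp add: artanh_def)
qed

lemma one_minus_cnj_mult_nonzero:
  assumes "norm w < 1" "norm z < 1"
  shows "1 - cnj w * z \<noteq> 0"
proof
  assume "1 - cnj w * z = 0"
  then have "norm w * norm z = 1"
    by (metis complex_mod_cnj eq_iff_diff_eq_0 norm_mult norm_one)
  moreover have "norm w * norm z < 1"
    using norm_mult_less[of w 1 z 1] assms by (simp add: norm_mult)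
  ultimately show False by simp
qed

text \<open>Exchanging the points changes the sign of the numerator and conjugates the
  denominator.\<close>

lemma norm_Moebius_function_swap:
  "norm (Moebius_function 0 z w) = norm (Moebius_function 0 w z)"
proof -
  have "norm (1 - cnj z * w) = norm (1 - cnj w * z)"
    by (metis complex_cnj_cnj complex_cnj_diff complex_cnj_mult complex_cnj_one complex_mod_cnj
        mult.commute)
  then show ?thesis
    by (simp add: Moebius_function_simple norm_divide norm_minus_commute)
qed

text \<open>Disc automorphisms preserve the pseudohyperbolic distance. In the quotient of
  \<open>eq1\<close> by \<open>eq2\<close> the factors \<open>B\<close> and \<open>C\<close> cancel,
  and what remains besides the Moebius function at \<open>a\<close> is the unimodular factor
  \<open>cnj A / A\<close>.\<close>

lemma norm_Moebius_function_invariant: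
  assumes a: "norm a < 1" and b: "norm b < 1" and c: "norm c < 1"
  shows "norm (Moebius_function 0 (Moebius_function 0 b a) (Moebius_function 0 b c))
    = norm (Moebius_function 0 a c)"
proof -
  define A where "A = 1 - cnj b * a"
  define C where "C = 1 - cnj b * c"
  define B where "B = 1 - cnj b * b"
  have nz: "A \<noteq> 0" "C \<noteq> 0" "B \<noteq> 0" "1 - cnj a * c \<noteq> 0"
    unfolding A_def B_def C_def by (intro one_minus_cnj_mult_nonzero assms)+
  then have "cnj A \<noteq> 0"
    by simp
  note nz = nz this
  have eq1: "(c - b) / C - (a - b) / A = (c - a) * B / (C * A)"
    using nz by (simp add: divide_simps) (simp add: A_def B_def C_def algebra_simps)
  have eq2: "1 - cnj ((a - b) / A) * ((c - b) / C) = (1 - cnj a * c) * B / (cnj A * C)"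
    using nz by (simp add: divide_simps) (simp add: A_def B_def C_def algebra_simps)
  have "Moebius_function 0 (Moebius_function 0 b a) (Moebius_function 0 b c)
      = ((c - a) * B / (C * A)) / ((1 - cnj a * c) * B / (cnj A * C))"
    by (simp only: Moebius_function_simple A_def[symmetric] C_def[symmetric] eq1 eq2)
  then show ?thesis
    using nz by (simp add: norm_divide norm_mult Moebius_function_simple)
qed

text \<open>By the identity for \<open>p\<close>, the squared modulus is
  \<open>1 - p / ?n^2\<close>. It grows with \<open>?n\<close>, and \<open>?n\<close> is at most
  \<open>1 + norm u * norm v\<close>.\<close>

lemma norm_Moebius_function_le:
  assumes u: "norm u < 1" and v: "norm v < 1"
  shows "norm (Moebius_function 0 u v) \<le> (norm u + norm v) / (1 + norm u * norm v)"
proof (rule power2_le_imp_le)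
  let ?n = "norm (1 - cnj u * v)"
  define p where "p = (1 - (norm u)\<^sup>2) * (1 - (norm v)\<^sup>2)"
  have p: "0 \<le> p"
    using u v by (simp add: p_def power_le_one)
  have n: "0 < ?n"
    using one_minus_cnj_mult_nonzero[OF u v] by simp
  have den: "0 < 1 + norm u * norm v"
    by (simp add: add_pos_nonneg)
  have "?n\<^sup>2 - (norm (v - u))\<^sup>2 = p"
    unfolding p_def cmod_power2 by (simp add: algebra_simps power2_eq_square)
  then have "(norm (v - u))\<^sup>2 = ?n\<^sup>2 - p"
    by simp
  then have "(norm (Moebius_function 0 u v))\<^sup>2 = (?n\<^sup>2 - p) / ?n\<^sup>2"
    by (simp only: Moebius_function_simple norm_divide power_divide)
  also have "\<dots> = 1 - p / ?n\<^sup>2"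
    using n by (simp add: diff_divide_distrib)
  also have "\<dots> \<le> 1 - p / (1 + norm u * norm v)\<^sup>2"
  proof -
    have "?n \<le> 1 + norm u * norm v"
      using norm_triangle_ineq4[of 1 "cnj u * v"] by (simp add: norm_mult)
    then have "?n\<^sup>2 \<le> (1 + norm u * norm v)\<^sup>2"
      using n by (intro power_mono) auto
    then show ?thesis
      using p n den by (intro diff_left_mono divide_left_mono mult_pos_pos zero_less_power)
  qed
  also have "\<dots> = ((norm u + norm v) / (1 + norm u * norm v))\<^sup>2"
    using den by (simp add: p_def field_simps) (simp add: algebra_simps power2_eq_square)
  finally show "(norm (Moebius_function 0 u v))\<^sup>2 \<le> \<dots>" .
qed auto

lemma poincare_dist_self [simp]: "poincare_dist z z = 0"
  by (simp add: poincare_dist_artanh Moebius_function_eq_zero)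

lemma poincare_dist_pos:
  assumes "norm z < 1" "norm w < 1" "z \<noteq> w"
  shows "0 < poincare_dist z w"
proof -
  have "0 < norm (Moebius_function 0 z w)"
    using assms one_minus_cnj_mult_nonzero[of z w] by (simp add: Moebius_function_simple)
  then show ?thesis
    using artanh_real_strict_mono[of 0 "norm (Moebius_function 0 z w)"] assms
    by (simp add: poincare_dist_artanh Moebius_function_norm_lt_1)
qed

lemma poincare_dist_commute: "poincare_dist z w = poincare_dist w z"
  by (simp add: poincare_dist_artanh norm_Moebius_function_swap[of z w])

lemma poincare_dist_triangle:
  assumes a: "norm a < 1" and b: "norm b < 1" and c: "norm c < 1"
  shows "poincare_dist a c \<le> poincare_dist a b + poincare_dist b c"
proof -
  define u where "u = Moebius_function 0 b a"
  define v where "v = Moebius_function 0 b c"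
  have u: "norm u < 1" and v: "norm v < 1"
    using assms by (simp_all add: u_def v_def Moebius_function_norm_lt_1)
  have den: "0 < 1 + norm u * norm v"
    by (simp add: add_pos_nonneg)
  \<comment> \<open>Expanded, this says \<open>norm u + norm v < 1 + norm u * norm v\<close>, which
    keeps the bound inside the range where \<open>artanh\<close> is monotone.\<close>
  have "0 < (1 - norm u) * (1 - norm v)"
    using u v by simp
  then have lt: "(norm u + norm v) / (1 + norm u * norm v) < 1"
    using den by (simp add: algebra_simps)
  have "artanh (norm (Moebius_function 0 a c))
      \<le> artanh ((norm u + norm v) / (1 + norm u * norm v))"
    using norm_Moebius_function_le[OF u v] norm_Moebius_function_invariant[OF a b c] lt
    by (intro artanh_real_mono) (auto simp: u_def v_def)
  also have "\<dots> = artanh (norm u) + artanh (norm v)"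
    using artanh_real_add u v by simp
  finally show ?thesis
    by (simp add: poincare_dist_artanh u_def v_def norm_Moebius_function_swap[of a b])
qed

subsection \<open>Holomorphic functions of several variables\<close>

lemma norm_complex_vec_scale: "norm (c *s x) = norm c * norm (x :: complex ^ 'n)"
  by (simp add: norm_vec_def norm_mult L2_set_right_distrib)

lemma bounded_linear_vec_scale: "bounded_linear (\<lambda>c. c *s (u :: complex ^ 'n))"
  by (rule bounded_linear_intro[where K = "norm u"])
    (auto simp: vec_eq_iff algebra_simps norm_complex_vec_scale)

lemma holomorphic_fun_on_imp_continuous_on:
  "holomorphic_fun_on f D \<Longrightarrow> continuous_on D f"
  unfolding holomorphic_fun_on_def continuous_on_eq_continuous_within
  using has_derivative_continuous by blast

lemma holomorphic_map_on_imp_continuous_on: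
  assumes "holomorphic_map_on f D"
  shows "continuous_on D f"
proof -
  have "continuous_on D (\<lambda>z. \<chi> i. vec_nth (f z) i)"
    using assms by (intro continuous_on_vec_lambda)
      (simp add: holomorphic_map_on_def holomorphic_fun_on_imp_continuous_on)
  then show ?thesis
    by simp
qed

lemma holomorphic_fun_on_const: "holomorphic_fun_on (\<lambda>z. c) D"
  unfolding holomorphic_fun_on_def by (intro ballI exI[of _ "\<lambda>v. 0"]) auto

lemma holomorphic_fun_on_affine_component:
  "holomorphic_fun_on (\<lambda>z :: complex ^ 'n. c * (z $ i - b)) D"
  unfolding holomorphic_fun_on_def
  by (intro ballI exI[of _ "\<lambda>v. c * (v $ i)"] conjI)
    (auto intro!: derivative_eq_intros bounded_linear_imp_has_derivative bounded_linear_vec_nth)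

lemma holomorphic_fun_on_linear_combination:
  fixes f :: "complex ^ 'n \<Rightarrow> complex ^ 'm"
  assumes "holomorphic_map_on f D"
  shows "holomorphic_fun_on (\<lambda>z. \<Sum>i\<in>UNIV. f z $ i * a i) D"
  unfolding holomorphic_fun_on_def
proof
  fix z assume "z \<in> D"
  then have "\<forall>i. \<exists>f'. ((\<lambda>z. f z $ i) has_derivative f') (at z within D) \<and>
      (\<forall>c v. f' (c *s v) = c * f' v)"
    using assms by (auto simp: holomorphic_map_on_def holomorphic_fun_on_def)
  then obtain F where F: "\<And>i. ((\<lambda>z. f z $ i) has_derivative F i) (at z within D)"
      "\<And>i c v. F i (c *s v) = c * F i v"
    by metis
  have "((\<lambda>z. \<Sum>i\<in>UNIV. f z $ i * a i) has_derivative (\<lambda>v. \<Sum>i\<in>UNIV. F i v * a i))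
      (at z within D)"
    by (intro has_derivative_sum has_derivative_mult_left F)
  then show "\<exists>f'. ((\<lambda>z. \<Sum>i\<in>UNIV. f z $ i * a i) has_derivative f') (at z within D) \<and>
      (\<forall>c v. f' (c *s v) = c * f' v)"
    by (auto simp: F(2) sum_distrib_left mult.assoc)
qed

text \<open>This reduces to one complex variable. Complex linearity gives
  \<open>f' (c *s u) = c * f' u\<close>, so the derivative along the line is multiplication by the
  number \<open>f' u\<close>.\<close>

lemma holomorphic_fun_on_complex_line:
  assumes f: "holomorphic_fun_on f D" and D: "open D"
    and S: "\<And>c. c \<in> S \<Longrightarrow> x + c *s u \<in> D"
  shows "(\<lambda>c. f (x + c *s u)) holomorphic_on S"
proof (unfold holomorphic_on_def, intro ballI)
  fix c assume c: "c \<in> S"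
  obtain f' where f': "(f has_derivative f') (at (x + c *s u) within D)"
      "\<And>c v. f' (c *s v) = c * f' v"
    using f S[OF c] unfolding holomorphic_fun_on_def by blast
  have "(f has_derivative f') (at (x + c *s u))"
    using f'(1) at_within_open[OF S[OF c] D] by simp
  moreover have "((\<lambda>c. x + c *s u) has_derivative (\<lambda>c. c *s u)) (at c within S)"
    by (auto intro!: derivative_eq_intros bounded_linear_imp_has_derivative
        bounded_linear_vec_scale)
  ultimately have "((\<lambda>c. f (x + c *s u)) has_derivative (\<lambda>c. f' (c *s u))) (at c within S)"
    by (rule has_derivative_compose[rotated])
  then have "((\<lambda>c. f (x + c *s u)) has_field_derivative f' u) (at c within S)"
    by (simp add: has_field_derivative_def f'(2) mult.commute[of _ "f' u"])
  then show "(\<lambda>c. f (x + c *s u)) field_differentiable at c within S"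
    by (auto simp: field_differentiable_def)
qed

text \<open>The Schwarz-Pick lemma on the disc of radius \<open>r\<close> in the complex line through \<open>x\<close> and \<open>y\<close>.\<close>

lemma Schwarz_Pick_ball:
  assumes f: "holomorphic_fun_on f D" "f ` D \<subseteq> ball 0 1" and D: "open D"
    and r: "ball x r \<subseteq> D" "y \<in> ball x r"
  shows "norm (Moebius_function 0 (f x) (f y)) \<le> dist x y / r"
proof (cases "x = y")
  case True
  then show ?thesis
    by (simp add: Moebius_function_eq_zero)
next
  case False
  have r0: "0 < r"
    using r(2) by (meson le_less_trans mem_ball zero_le_dist)
  \<comment> \<open>The scaling gives \<open>norm u = r\<close>: the unit disc parametrizes a disc
    of radius \<open>r\<close> about \<open>x\<close>, with \<open>y\<close> at the parameter
    \<open>t\<close>.\<close>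
  define t where "t = dist x y / r"
  define u where "u = of_real (1 / t) *s (y - x)"
  have t: "0 < t" "t < 1"
    using False r0 r(2) by (auto simp: t_def)
  have "norm u = dist x y / t"
    using t(1) unfolding u_def norm_complex_vec_scale norm_of_real
    by (simp add: dist_norm norm_minus_commute)
  then have "norm u = r"
    using False r0 by (simp add: t_def)
  then have inD: "x + c *s u \<in> D" if "c \<in> ball 0 1" for c
    using that r0 by (intro subsetD[OF r(1)]) (simp add: dist_norm norm_complex_vec_scale)
  have y: "x + of_real t *s u = y"
    using t by (simp add: u_def vec_eq_iff)
  define h where "h = (\<lambda>c. f (x + c *s u))"
  have h: "h holomorphic_on ball 0 1" "h ` ball 0 1 \<subseteq> ball 0 1"
    using holomorphic_fun_on_complex_line[OF f(1) D inD] inD f(2) unfolding h_def by blast+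
  have hx: "h 0 = f x" and hy: "h (of_real t) = f y"
    by (simp_all add: h_def y)
  have fx: "norm (f x) < 1"
    using h(2) by (metis centre_in_ball hx image_subset_iff mem_ball_0 zero_less_one)
  \<comment> \<open>An automorphism moves \<open>f x\<close> to 0, as the Schwarz lemma demands;
    evaluating at \<open>t\<close> gives the claim.\<close>
  have "norm ((Moebius_function 0 (f x) \<circ> h) (of_real t)) \<le> norm (of_real t :: complex)"
  proof (rule Schwarz_Lemma)
    show "(Moebius_function 0 (f x) \<circ> h) holomorphic_on ball 0 1"
      by (rule holomorphic_on_compose_gen[OF h(1) Moebius_function_holomorphic[OF fx] h(2)])
    show "(Moebius_function 0 (f x) \<circ> h) 0 = 0"
      by (simp add: hx Moebius_function_eq_zero)
    show "norm ((Moebius_function 0 (f x) \<circ> h) z) < 1" if "norm z < 1" for z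
      using h(2) that fx by (simp add: image_subset_iff Moebius_function_norm_lt_1)
    show "norm (of_real t :: complex) < 1"
      using t by simp
  qed
  then show ?thesis
    using t by (simp add: hy flip: t_def)
qed

lemma poincare_dist_le_ball:
  assumes "holomorphic_fun_on f D" "f ` D \<subseteq> ball 0 1" "open D" "ball x r \<subseteq> D" "y \<in> ball x r"
  shows "poincare_dist (f x) (f y) \<le> 2 * artanh (dist x y / r)"
proof -
  have "0 < r"
    using assms(5) by (meson le_less_trans mem_ball zero_le_dist)
  then have "dist x y / r < 1"
    using assms(5) by simp
  then show ?thesis
    using Schwarz_Pick_ball[OF assms] by (simp add: poincare_dist_artanh artanh_real_mono)
qed

subsection \<open>The Caratheodory distance\<close>

abbreviation disc_functions :: "(complex ^ 'n) set \<Rightarrow> (complex ^ 'n \<Rightarrow> complex) set" where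
  "disc_functions D \<equiv> {f. holomorphic_fun_on f D \<and> f ` D \<subseteq> ball 0 1}"

lemma zero_in_disc_functions: "(\<lambda>z. 0) \<in> disc_functions D"
  by (auto simp: holomorphic_fun_on_const)

text \<open>Boundedness for a pair of points is symmetric and transitive, and each point of
  \<open>D\<close> is related to a whole neighbourhood of itself; connectedness extends it to all
  pairs. Only then is the supremum an upper bound of its members.\<close>

lemma bdd_above_poincare_dist:
  assumes D: "open D" "connected D" and "x \<in> D" "y \<in> D"
  shows "bdd_above ((\<lambda>f. poincare_dist (f x) (f y)) ` disc_functions D)"
proof (rule connected_equivalence_relation[OF D(2) assms(3,4),
    where R = "\<lambda>x y. bdd_above ((\<lambda>f. poincare_dist (f x) (f y)) ` disc_functions D)"])
  show "bdd_above ((\<lambda>f. poincare_dist (f y) (f x)) ` disc_functions D)"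
    if "bdd_above ((\<lambda>f. poincare_dist (f x) (f y)) ` disc_functions D)" for x y
    using that by (subst poincare_dist_commute)
next
  fix x y z
  assume xy: "bdd_above ((\<lambda>f. poincare_dist (f x) (f y)) ` disc_functions D)"
    and yz: "bdd_above ((\<lambda>f. poincare_dist (f y) (f z)) ` disc_functions D)"
    and D': "x \<in> D" "y \<in> D" "z \<in> D"
  from xy obtain B where B: "\<And>f. f \<in> disc_functions D \<Longrightarrow> poincare_dist (f x) (f y) \<le> B"
    by (auto simp: bdd_above_def)
  from yz obtain C where C: "\<And>f. f \<in> disc_functions D \<Longrightarrow> poincare_dist (f y) (f z) \<le> C"
    by (auto simp: bdd_above_def)
  have "poincare_dist (f x) (f z) \<le> B + C" if f: "f \<in> disc_functions D" for f
  proof -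
    have "norm (f x) < 1" "norm (f y) < 1" "norm (f z) < 1"
      using f D' by (auto simp: image_subset_iff)
    then show ?thesis
      using poincare_dist_triangle B[OF f] C[OF f] by (smt (verit))
  qed
  then show "bdd_above ((\<lambda>f. poincare_dist (f x) (f z)) ` disc_functions D)"
    by (intro bdd_aboveI2)
next
  fix a assume "a \<in> D"
  then obtain r where r: "0 < r" "ball a r \<subseteq> D"
    using D(1) openE by blast
  \<comment> \<open>The Schwarz-Pick bound \<open>2 * artanh (dist a x / r)\<close> does not depend
    on \<open>f\<close>.\<close>
  have "bdd_above ((\<lambda>f. poincare_dist (f a) (f x)) ` disc_functions D)" if "x \<in> ball a r" for x
    using poincare_dist_le_ball[OF _ _ D(1) r(2) that] by (intro bdd_aboveI2) auto
  then show "\<exists>T. openin (top_of_set D) T \<and> a \<in> T \<and>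
      (\<forall>x\<in>T. bdd_above ((\<lambda>f. poincare_dist (f a) (f x)) ` disc_functions D))"
    using r D(1) by (intro exI[of _ "ball a r"]) (auto simp: openin_open_eq)
qed

lemma poincare_dist_le_caratheodory_dist:
  assumes "open D" "connected D" "x \<in> D" "y \<in> D" "holomorphic_fun_on f D" "f ` D \<subseteq> ball 0 1"
  shows "poincare_dist (f x) (f y) \<le> caratheodory_dist D x y"
  using assms bdd_above_poincare_dist[OF assms(1-4)]
  by (auto simp: caratheodory_dist_def intro!: cSUP_upper)

lemma caratheodory_dist_le:
  assumes "x \<in> D" "y \<in> D"
    and "\<And>f. \<lbrakk>holomorphic_fun_on f D; f ` D \<subseteq> ball 0 1\<rbrakk> \<Longrightarrow> poincare_dist (f x) (f y) \<le> B"
  shows "caratheodory_dist D x y \<le> B"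
proof -
  have "disc_functions D \<noteq> {}"
    using zero_in_disc_functions by blast
  then show ?thesis
    using assms by (auto simp: caratheodory_dist_def intro!: cSUP_least)
qed

lemma caratheodory_dist_le_ball:
  assumes "open D" "ball x r \<subseteq> D" "y \<in> ball x r"
  shows "caratheodory_dist D x y \<le> 2 * artanh (dist x y / r)"
proof (rule caratheodory_dist_le)
  show "y \<in> D"
    using assms by auto
  have "0 < r"
    using assms(3) by (meson le_less_trans mem_ball zero_le_dist)
  then show "x \<in> D"
    using assms by auto
qed (use poincare_dist_le_ball assms in auto)

lemma Metric_space_caratheodory_dist:
  assumes "bounded_domain D"
  shows "Metric_space D (caratheodory_dist D)"
proof
  have D: "open D" "connected D" "bounded D"
    using assms by (auto simp: bounded_domain_def)
  note upper = poincare_dist_le_caratheodory_dist[OF D(1,2)]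
  fix x y z
  show "0 \<le> caratheodory_dist D x y"
  proof (cases "x \<in> D \<and> y \<in> D")
    case True
    \<comment> \<open>The zero function competes in the supremum with value 0.\<close>
    then show ?thesis
      using upper[of x y "\<lambda>z. 0"] zero_in_disc_functions[of D] by auto
  qed (auto simp: caratheodory_dist_def)
  show "caratheodory_dist D x y = caratheodory_dist D y x"
    unfolding caratheodory_dist_def by (subst poincare_dist_commute) auto
  assume x: "x \<in> D" and y: "y \<in> D"
  show "caratheodory_dist D x y = 0 \<longleftrightarrow> x = y"
  proof
    assume eq: "caratheodory_dist D x y = 0"
    obtain R where R: "0 < R" "\<And>z. z \<in> D \<Longrightarrow> norm z \<le> R"
      using D(3) bounded_pos by metis
    show "x = y"
    proof (rule ccontr)
      assume "x \<noteq> y"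
      then obtain i where i: "x $ i \<noteq> y $ i"
        by (auto simp: vec_eq_iff)
      \<comment> \<open>A coordinate in which \<open>x\<close> and \<open>y\<close> differ, scaled
        into the disc; \<open>R + 1\<close> instead of \<open>R\<close> makes the inclusion in the
        open disc strict. The subtraction of 0 matches
        \<open>holomorphic_fun_on_affine_component\<close>.\<close>
      define f where "f = (\<lambda>z :: complex ^ 'a. of_real (1 / (R + 1)) * (z $ i - 0))"
      have "norm (z $ i) < R + 1" if "z \<in> D" for z
        using R(2)[OF that] Finite_Cartesian_Product.norm_nth_le[of z i] by linarith
      then have sub: "f ` D \<subseteq> ball 0 1"
        using R(1) by (auto simp: f_def norm_mult norm_divide)
      have hol: "holomorphic_fun_on f D"
        unfolding f_def by (rule holomorphic_fun_on_affine_component)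
      have "f x \<noteq> f y"
        using i R(1) by (simp add: f_def) (smt (verit) of_real_eq_0_iff of_real_1 of_real_add)
      then have "0 < poincare_dist (f x) (f y)"
        using sub x y by (intro poincare_dist_pos) (auto simp: image_subset_iff)
      then show False
        using upper[OF x y hol sub] eq by simp
    qed
  next
    assume "x = y"
    moreover have "disc_functions D \<noteq> {}"
      using zero_in_disc_functions by blast
    ultimately show "caratheodory_dist D x y = 0"
      by (simp add: caratheodory_dist_def)
  qed
  assume z: "z \<in> D"
  show "caratheodory_dist D x z \<le> caratheodory_dist D x y + caratheodory_dist D y z"
  proof (rule caratheodory_dist_le[OF x z])
    fix f assume f: "holomorphic_fun_on f D" "f ` D \<subseteq> ball 0 1"
    then have "poincare_dist (f x) (f z) \<le> poincare_dist (f x) (f y) + poincare_dist (f y) (f z)"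
      using x y z by (intro poincare_dist_triangle) (auto simp: image_subset_iff)
    then show "poincare_dist (f x) (f z) \<le> caratheodory_dist D x y + caratheodory_dist D y z"
      using upper[OF x y f] upper[OF y z f] by linarith
  qed
qed

text \<open>On a Euclidean ball about \<open>x\<close> inside \<open>D\<close> the Schwarz-Pick
  bound holds, and \<open>artanh\<close> is continuous at 0 with value 0.\<close>

lemma limitin_caratheodory_dist:
  assumes D: "bounded_domain D" and x: "x \<in> D" and lim: "X \<longlonglongrightarrow> x"
  shows "limitin (Metric_space.mtopology D (caratheodory_dist D)) X x sequentially"
proof -
  interpret Metric_space D "caratheodory_dist D"
    using D by (rule Metric_space_caratheodory_dist)
  have "open D"
    using D by (simp add: bounded_domain_def)
  then obtain r where r: "0 < r" "ball x r \<subseteq> D"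
    using x openE by blast
  have ev: "\<forall>\<^sub>F n in sequentially. X n \<in> ball x r"
    using lim r(1) by (intro topological_tendstoD) auto
  have "(\<lambda>n. 2 * artanh (dist x (X n) / r)) \<longlonglongrightarrow> 2 * artanh (dist x x / r)"
    using r(1) by (intro tendsto_intros lim) auto
  then have "(\<lambda>n. 2 * artanh (dist x (X n) / r)) \<longlonglongrightarrow> 0"
    by simp
  then have "(\<lambda>n. caratheodory_dist D (X n) x) \<longlonglongrightarrow> 0"
  proof (rule tendsto_sandwich[OF _ _ tendsto_const, rotated 2])
    show "\<forall>\<^sub>F n in sequentially. 0 \<le> caratheodory_dist D (X n) x"
      by simp
    show "\<forall>\<^sub>F n in sequentially. caratheodory_dist D (X n) x \<le> 2 * artanh (dist x (X n) / r)"
      using ev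
    proof eventually_elim
      case (elim n)
      show ?case
        using caratheodory_dist_le_ball[OF \<open>open D\<close> r(2) elim] commute[of x "X n"] by simp
    qed
  qed
  moreover have "\<forall>\<^sub>F n in sequentially. X n \<in> D"
    using ev by eventually_elim (use r(2) in blast)
  ultimately show ?thesis
    using x by (simp add: limitin_metric_dist_null)
qed

subsection \<open>Squeezing maps\<close>

text \<open>The supremum over an empty set of reals would be unspecified. Translating
  \<open>p\<close> to 0 and shrinking gives a member.\<close>

lemma squeezing_maps_nonempty:
  fixes D :: "(complex ^ 'n) set"
  assumes "bounded_domain D"
  shows "squeezing_maps D p \<noteq> {}"
proof -
  have D: "open D" "bounded D"
    using assms by (auto simp: bounded_domain_def)
  obtain R where R: "0 < R" "\<And>z. z \<in> D \<Longrightarrow> norm z \<le> R"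
    using D(2) bounded_pos by metis
  \<comment> \<open>\<open>R + norm p\<close> bounds \<open>norm (z - p)\<close> on
    \<open>D\<close>; adding 1 makes the bound strict and the denominator positive.\<close>
  define k where "k = 1 / (R + norm p + 1)"
  have k: "0 < k"
    using R(1) by (simp add: k_def add_pos_nonneg)
  define f where "f = (\<lambda>z :: complex ^ 'n. k *\<^sub>R (z - p))"
  have "holomorphic_map_on f D"
  proof -
    have "(\<lambda>z. f z $ i) = (\<lambda>z. of_real k * (z $ i - p $ i))" for i
      by (simp add: f_def scaleR_conv_of_real[where 'a = complex] fun_eq_iff)
    then show ?thesis
      by (simp add: holomorphic_map_on_def holomorphic_fun_on_affine_component)
  qed
  moreover have "inj_on f D"
    using k by (auto simp: inj_on_def f_def)
  moreover have "open_map (top_of_set D) euclidean f"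
  proof -
    have "open (f ` U)" if "open U" for U
    proof -
      have "f ` U = (*\<^sub>R) k ` ((\<lambda>z. - p + z) ` U)"
        by (auto simp: f_def image_image)
      then show ?thesis
        using open_scaling[OF _ open_translation[OF that, of "- p"], of k] k by simp
    qed
    then show ?thesis
      using D(1) by (auto simp: open_map_def openin_open_eq)
  qed
  moreover have "f ` D \<subseteq> ball 0 1"
  proof (clarsimp simp: f_def)
    fix z assume "z \<in> D"
    then have "norm (z - p) < R + norm p + 1"
      using norm_triangle_ineq4[of z p] R(2)[of z] by linarith
    then show "\<bar>k\<bar> * norm (z - p) < 1"
      using R(1) by (simp add: k_def abs_of_pos add_pos_nonneg)
  qed
  moreover have "f p = 0"
    by (simp add: f_def)
  ultimately show ?thesis
    unfolding squeezing_maps_def by blast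
qed

text \<open>A number strictly below a supremum is strictly below some member. This is applied first
  to the maps, then to the radii; the radius found exceeds \<open>r\<close>, and balls about 0 are
  nested.\<close>

lemma squeezing_function_greater:
  fixes D :: "(complex ^ 'n) set"
  assumes "bounded_domain D" and r: "r < squeezing_function D p"
  obtains f where "f \<in> squeezing_maps D p" "ball 0 r \<subseteq> f ` D"
proof -
  obtain f where f: "f \<in> squeezing_maps D p" "r < Sup {r. ball 0 r \<subseteq> f ` D}"
    using r cSUP_least[OF squeezing_maps_nonempty[OF assms(1)], of p _ r]
    unfolding squeezing_function_def by (meson not_le)
  define S where "S = {r. ball 0 r \<subseteq> f ` D}"
  \<comment> \<open>The ball of radius 0 is empty, so \<open>S\<close> has a member.\<close>
  have "0 \<in> S"
    by (simp add: S_def)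
  then obtain r' where "r' \<in> S" "r < r'"
    using f(2) cSup_least[of S r] unfolding S_def[symmetric] by fastforce
  then have "ball 0 r \<subseteq> f ` D"
    using subset_ball[of r r' "0 :: complex ^ 'n"] unfolding S_def by simp
  then show ?thesis
    using that f(1) by blast
qed

text \<open>The supporting linear functional at \<open>f z\<close> composed with \<open>f\<close> competes in the supremum.\<close>

lemma caratheodory_dist_squeezing_map:
  fixes D :: "(complex ^ 'n) set"
  assumes D: "bounded_domain D" and f: "f \<in> squeezing_maps D p" and p: "p \<in> D" and z: "z \<in> D"
  shows "2 * artanh (norm (f z)) \<le> caratheodory_dist D p z"
proof -
  have f': "holomorphic_map_on f D" "f ` D \<subseteq> ball 0 1" "f p = 0"
    using f by (auto simp: squeezing_maps_def)
  \<comment> \<open>If \<open>f z = 0\<close>, division by zero makes \<open>g\<close> the zero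
    function, and the estimate reads \<open>0 \<le> caratheodory_dist D p z\<close>; no case split
    is needed.\<close>
  define g where "g = (\<lambda>w. \<Sum>i\<in>UNIV. f w $ i * (cnj (f z $ i) / of_real (norm (f z))))"
  have hol: "holomorphic_fun_on g D"
    unfolding g_def by (rule holomorphic_fun_on_linear_combination[OF f'(1)])
  have geq: "g w = (\<Sum>i\<in>UNIV. f w $ i * cnj (f z $ i)) / of_real (norm (f z))" for w
    by (simp add: g_def sum_divide_distrib)
  \<comment> \<open>This is the Cauchy-Schwarz inequality, and it keeps \<open>g\<close> inside the
    unit disc.\<close>
  have "norm (g w) \<le> norm (f w)" for w
  proof -
    have "norm (\<Sum>i\<in>UNIV. f w $ i * cnj (f z $ i)) \<le> (\<Sum>i\<in>UNIV. norm (f w $ i) * norm (f z $ i))"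
      by (rule order_trans[OF norm_sum]) (simp add: norm_mult)
    also have "\<dots> \<le> norm (f w) * norm (f z)"
      using L2_set_mult_ineq[of "\<lambda>i. norm (f w $ i)" "\<lambda>i. norm (f z $ i)" UNIV]
      by (simp add: norm_vec_def)
    finally show ?thesis
      by (simp add: geq norm_divide divide_simps)
  qed
  then have sub: "g ` D \<subseteq> ball 0 1"
    using f'(2) by (auto simp: image_subset_iff intro: le_less_trans)
  have "g z = of_real (norm (f z))"
  proof -
    have "(\<Sum>i\<in>UNIV. f z $ i * cnj (f z $ i)) = of_real (\<Sum>i\<in>UNIV. (norm (f z $ i))\<^sup>2)"
      by (simp only: of_real_sum complex_norm_square)
    also have "\<dots> = of_real ((norm (f z))\<^sup>2)"
      by (simp add: norm_vec_def L2_set_def sum_nonneg)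
    finally show ?thesis
      by (simp add: geq power2_eq_square)
  qed
  moreover have "g p = 0"
    by (simp add: g_def f'(3))
  ultimately have "poincare_dist (g p) (g z) = 2 * artanh (norm (f z))"
    by (simp add: poincare_dist_artanh Moebius_function_simple)
  moreover have "open D" "connected D"
    using D by (auto simp: bounded_domain_def)
  ultimately show ?thesis
    using poincare_dist_le_caratheodory_dist[OF _ _ p z hol sub] by simp
qed

lemma compact_caratheodory_ball:
  assumes D: "bounded_domain D" and p: "p \<in> D" and f: "f \<in> squeezing_maps D p"
    and t: "0 \<le> t" "t < r" and r: "ball 0 r \<subseteq> f ` D"
  obtains K where "compact K" "K \<subseteq> D"
    "\<And>z. \<lbrakk>z \<in> D; caratheodory_dist D p z < 2 * artanh t\<rbrakk> \<Longrightarrow> z \<in> K"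
proof -
  have f': "holomorphic_map_on f D" "inj_on f D" "open_map (top_of_set D) euclidean f"
      "f ` D \<subseteq> ball 0 1"
    using f by (auto simp: squeezing_maps_def)
  obtain g where g: "homeomorphism D (f ` D) f g"
  proof (rule homeomorphism_injective_open_map[OF _ refl f'(2)])
    show "continuous_on D f"
      by (rule holomorphic_map_on_imp_continuous_on[OF f'(1)])
    show "openin (top_of_set (f ` D)) (f ` U)" if "openin (top_of_set D) U" for U
    proof (rule open_subset)
      show "f ` U \<subseteq> f ` D"
        using openin_imp_subset[OF that] by blast
      show "open (f ` U)"
        using f'(3) that by (simp add: open_map_def)
    qed
  qed
  have sub: "cball 0 t \<subseteq> f ` D"
    using t r by (auto simp: subset_iff)
  show ?thesis
  proof
    show "compact (g ` cball 0 t)"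
      using g sub by (meson compact_cball compact_continuous_image continuous_on_subset
          homeomorphism_cont2)
    show "g ` cball 0 t \<subseteq> D"
      using g sub by (metis homeomorphism_image2 image_mono)
    fix z assume z: "z \<in> D" "caratheodory_dist D p z < 2 * artanh t"
    have "norm (f z) < 1"
      using f'(4) z(1) by (simp add: image_subset_iff)
    moreover have "artanh (norm (f z)) < artanh t"
      using caratheodory_dist_squeezing_map[OF D f p z(1)] z(2) by simp
    \<comment> \<open>If \<open>t < norm (f z)\<close>, monotonicity of \<open>artanh\<close> below
      1 would contradict the preceding inequality.\<close>
    ultimately have "norm (f z) \<le> t"
      using artanh_real_mono[of t "norm (f z)"] t(1) by linarith
    then have "f z \<in> cball 0 t"
      by simp
    moreover have "g (f z) = z"
      using g z(1) by (simp add: homeomorphism_apply1)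
    ultimately show "z \<in> g ` cball 0 t"
      by (metis imageI)
  qed
qed

section \<open>Completeness of the Caratheodory distance\<close>

theorem theorem4p4:
  fixes D :: "(complex ^ 'n) set"
  assumes "holomorphic_homogeneous_regular D"
  shows "Metric_space D (caratheodory_dist D) \<and> Metric_space.mcomplete D (caratheodory_dist D)"
proof
  have D: "bounded_domain D"
    using assms by (simp add: holomorphic_homogeneous_regular_def)
  obtain c where c: "0 < c" "\<And>p. p \<in> D \<Longrightarrow> c \<le> squeezing_function D p"
    using assms by (auto simp: holomorphic_homogeneous_regular_def)
  \<comment> \<open>Half of \<open>c\<close> lies strictly below the squeezing function, so that
    some map attains the radius \<open>r\<close>. The cap 1/2 yields \<open>r < 1\<close> without
    comparing \<open>c\<close> with 1. The Caratheodory radius below uses \<open>r / 2\<close>,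
    which is strictly less than \<open>r\<close>.\<close>
  define r where "r = min (c / 2) (1 / 2)"
  have r: "0 < r" "r < 1" "r < c"
    using c(1) by (auto simp: r_def)
  have pos: "0 < 2 * artanh (r / 2)"
    using artanh_real_strict_mono[of 0 "r / 2"] r by simp
  show "Metric_space D (caratheodory_dist D)"
    using D by (rule Metric_space_caratheodory_dist)
  then interpret Metric_space D "caratheodory_dist D" .
  show mcomplete
    unfolding mcomplete_def
  proof (intro allI impI)
    fix X assume X: "MCauchy X"
    then have XD: "X n \<in> D" for n
      unfolding MCauchy_def by blast
    \<comment> \<open>The radius was fixed before \<open>N\<close>, so the point \<open>X N\<close>
      can serve as the centre of a ball containing the whole tail; \<open>f\<close> and
      \<open>K\<close> may depend on \<open>N\<close>.\<close>
    obtain N where N: "\<And>n. N \<le> n \<Longrightarrow> caratheodory_dist D (X N) (X n) < 2 * artanh (r / 2)"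
      using X pos unfolding MCauchy_def by (meson order_refl)
    obtain f where f: "f \<in> squeezing_maps D (X N)" "ball 0 r \<subseteq> f ` D"
      using squeezing_function_greater[OF D, of r "X N"] c(2)[OF XD] r(3) by (metis less_le_trans)
    obtain K where K: "compact K" "K \<subseteq> D"
      "\<And>z. \<lbrakk>z \<in> D; caratheodory_dist D (X N) z < 2 * artanh (r / 2)\<rbrakk> \<Longrightarrow> z \<in> K"
      using compact_caratheodory_ball[OF D XD f(1) _ _ f(2), of "r / 2"] r(1) by auto
    have "\<forall>n. X (N + n) \<in> K"
      using K(3) N XD by simp
    then obtain x s where x: "x \<in> K" "strict_mono s" "((\<lambda>n. X (N + n)) \<circ> s) \<longlonglongrightarrow> x"
      using K(1) unfolding compact_eq_seq_compact_metric seq_compact_def by metis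
    \<comment> \<open>The shift by \<open>N\<close> turns a subsequence of the tail into a
      subsequence of \<open>X\<close>.\<close>
    define s' where "s' = (\<lambda>n. N + s n)"
    have "strict_mono s'"
      using x(2) by (simp add: s'_def strict_mono_def)
    \<comment> \<open>The Euclidean limit lies in \<open>K\<close>, hence in \<open>D\<close> and
      not on its boundary, so convergence passes to the Caratheodory distance. A Cauchy sequence
      with a convergent subsequence converges.\<close>
    moreover have "limitin mtopology (X \<circ> s') x sequentially"
      using x K(2) by (intro limitin_caratheodory_dist[OF D]) (auto simp: s'_def o_def)
    ultimately show "\<exists>x. limitin mtopology X x sequentially"
      using MCauchy_convergent_subsequence[OF X] by blast
  qed
qed

end
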